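(* Thompson's group $F=\langle x_0,x_1 \mid [x_0x_1^{-1},x_0^{-1}x_1x_0],\ [x_0x_1^{-1},x_0^{-2}x_1x_0^{2}]\rangle$ has infinitely many cone types with respect to the generating set $\{x_0,x_1\}$.
   Context: Let $G$ be a group with the word metric $d$ of a finite generating set $X$. A path $p$ in the Cayley graph is outbound if $d(1,p(s))$ is a strictly increasing function of $s$. The cone at $g\in G$ is the set $C'(g)$ of all outbound paths starting at $g$, and the cone type of $g$ is $C(g)=g^{-1}C'(g)$. (In the discrete setting, paths are edge paths, and $C(g)$ can be identified with the set of words $x_1\cdots x_n$ over $X\cup X^{-1}$ such that $d(1,gx_1\cdots x_i)=d(1,g)+i$ for all $1\le i\le n$.) *)

theory Defs
  imports "HOL-Algebra.Generated_Groups"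
begin

section \<open>Group presentations\<close>

text \<open>A letter \<open>(x, True)\<close> stands for the generator \<open>x\<close>, and \<open>(x, False)\<close> for its formal inverse.
  All elements of the type \<open>'a\<close> are generators.\<close>

type_synonym 'a gword = "('a \<times> bool) list"

definition gword_inv :: "'a gword \<Rightarrow> 'a gword" where
  "gword_inv w = rev (map (\<lambda>(x, b). (x, \<not> b)) w)"

text \<open>The other common convention, \<open>u\<inverse> v\<inverse> u v\<close>, has the same normal closure: either word is
  trivial in a group iff \<open>u\<close> and \<open>v\<close> commute there.\<close>

definition gword_comm :: "'a gword \<Rightarrow> 'a gword \<Rightarrow> 'a gword" where
  "gword_comm u v = u @ v @ gword_inv u @ gword_inv v"

inductive pres_eq :: "'a gword set \<Rightarrow> 'a gword \<Rightarrow> 'a gword \<Rightarrow> bool" for R where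
  refl: "pres_eq R u u"
| sym: "pres_eq R u v \<Longrightarrow> pres_eq R v u"
| trans: "pres_eq R u v \<Longrightarrow> pres_eq R v w \<Longrightarrow> pres_eq R u w"
| append: "pres_eq R u u' \<Longrightarrow> pres_eq R v v' \<Longrightarrow> pres_eq R (u @ v) (u' @ v')"
| cancel: "pres_eq R [(x, b), (x, \<not> b)] []"
| relator: "r \<in> R \<Longrightarrow> pres_eq R r []"

definition pres_class :: "'a gword set \<Rightarrow> 'a gword \<Rightarrow> 'a gword set" where
  "pres_class R u = {v. pres_eq R u v}"

definition presented_group :: "'a gword set \<Rightarrow> 'a gword set monoid" where
  "presented_group R =
    \<lparr>carrier = range (pres_class R),
     mult = (\<lambda>A B. \<Union>a\<in>A. \<Union>b\<in>B. pres_class R (a @ b)),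
     one = pres_class R []\<rparr>"

definition pres_gen :: "'a gword set \<Rightarrow> 'a \<Rightarrow> 'a gword set" where
  "pres_gen R x = pres_class R [(x, True)]"

lemma pres_class_eq_iff: "pres_class R u = pres_class R v \<longleftrightarrow> pres_eq R u v"
proof
  assume "pres_class R u = pres_class R v"
  then have "v \<in> pres_class R u" by (simp add: pres_class_def pres_eq.refl)
  then show "pres_eq R u v" by (simp add: pres_class_def)
next
  assume uv: "pres_eq R u v"
  have "pres_eq R u w \<longleftrightarrow> pres_eq R v w" for w
    using pres_eq.trans[OF uv] pres_eq.trans[OF pres_eq.sym[OF uv]] by blast
  then show "pres_class R u = pres_class R v" by (simp add: pres_class_def)
qed

lemma presented_group_mult:
  "pres_class R u \<otimes>\<^bsub>presented_group R\<^esub> pres_class R v = pres_class R (u @ v)"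
proof -
  have "pres_class R (a @ b) = pres_class R (u @ v)"
    if "a \<in> pres_class R u" "b \<in> pres_class R v" for a b
  proof -
    from that have "pres_eq R u a" "pres_eq R v b" by (simp_all add: pres_class_def)
    then show ?thesis unfolding pres_class_eq_iff by (intro pres_eq.sym[OF pres_eq.append])
  qed
  moreover have "u \<in> pres_class R u" "v \<in> pres_class R v"
    by (simp_all add: pres_class_def pres_eq.refl)
  ultimately have "(\<Union>a\<in>pres_class R u. \<Union>b\<in>pres_class R v. pres_class R (a @ b)) =
      pres_class R (u @ v)"
    by blast
  then show ?thesis by (simp add: presented_group_def)
qed

lemma pres_eq_inv: "pres_eq R (gword_inv w @ w) []"
proof (induction w)
  case Nil
  show ?case by (simp add: gword_inv_def pres_eq.refl)
next
  case (Cons l w)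
  obtain x b where l: "l = (x, b)" by fastforce
  have "pres_eq R ([(x, \<not> b), (x, b)] @ w) ([] @ w)"
    using pres_eq.append[OF pres_eq.cancel[of R x "\<not> b"] pres_eq.refl[of R w]] by simp
  then have "pres_eq R (gword_inv w @ [(x, \<not> b), (x, b)] @ w) (gword_inv w @ [] @ w)"
    by (rule pres_eq.append[OF pres_eq.refl])
  then have "pres_eq R (gword_inv (l # w) @ l # w) (gword_inv w @ w)"
    by (simp add: gword_inv_def l)
  then show ?case using Cons by (rule pres_eq.trans)
qed

lemma carrier_presented_group: "carrier (presented_group R) = range (pres_class R)"
  by (simp add: presented_group_def)

lemma one_presented_group: "\<one>\<^bsub>presented_group R\<^esub> = pres_class R []"
  by (simp add: presented_group_def)

lemma group_presented_group: "group (presented_group R)"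
proof (rule groupI)
  fix A assume "A \<in> carrier (presented_group R)"
  then obtain w where A: "A = pres_class R w" by (auto simp: carrier_presented_group)
  have "pres_class R (gword_inv w) \<otimes>\<^bsub>presented_group R\<^esub> A = \<one>\<^bsub>presented_group R\<^esub>"
    unfolding A presented_group_mult one_presented_group pres_class_eq_iff by (rule pres_eq_inv)
  then show "\<exists>B\<in>carrier (presented_group R). B \<otimes>\<^bsub>presented_group R\<^esub> A = \<one>\<^bsub>presented_group R\<^esub>"
    by (auto simp: carrier_presented_group)
qed (auto simp: carrier_presented_group one_presented_group presented_group_mult)

lemma inv_pres_class:
  "inv\<^bsub>presented_group R\<^esub> pres_class R w = pres_class R (gword_inv w)"
  by (rule group.inv_equality[OF group_presented_group])
    (auto simp: presented_group_mult one_presented_group carrier_presented_group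
      pres_class_eq_iff pres_eq_inv)

lemma generate_pres_gen:
  "generate (presented_group R) (range (pres_gen R)) = carrier (presented_group R)"
proof
  show "generate (presented_group R) (range (pres_gen R)) \<subseteq> carrier (presented_group R)"
    by (rule group.generate_incl[OF group_presented_group])
      (auto simp: carrier_presented_group pres_gen_def)
  have "pres_class R w \<in> generate (presented_group R) (range (pres_gen R))" for w
  proof (induction w)
    case Nil
    show ?case using generate.one by (metis one_presented_group)
  next
    case (Cons l w)
    obtain x b where l: "l = (x, b)" by fastforce
    have "pres_class R [l] \<in> generate (presented_group R) (range (pres_gen R))"
    proof (cases b)
      case True
      then show ?thesis by (simp add: l pres_gen_def[symmetric] generate.incl)
    next
      case False
      then have "pres_class R [l] = inv\<^bsub>presented_group R\<^esub> pres_gen R x"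
        by (simp add: l pres_gen_def inv_pres_class gword_inv_def)
      then show ?thesis by (simp add: generate.inv)
    qed
    from generate.eng[OF this Cons] show ?case by (simp add: presented_group_mult)
  qed
  then show "carrier (presented_group R) \<subseteq> generate (presented_group R) (range (pres_gen R))"
    by (auto simp: carrier_presented_group)
qed

section \<open>Word metric and cone types\<close>

definition sym_gens :: "('g, 'b) monoid_scheme \<Rightarrow> 'g set \<Rightarrow> 'g set" where
  "sym_gens G X = X \<union> m_inv G ` X"

definition word_length :: "('g, 'b) monoid_scheme \<Rightarrow> 'g set \<Rightarrow> 'g \<Rightarrow> nat" where
  "word_length G X g =
    (LEAST n. \<exists>w. length w = n \<and> set w \<subseteq> sym_gens G X \<and> foldr (mult G) w \<one>\<^bsub>G\<^esub> = g)"

definition word_dist :: "('g, 'b) monoid_scheme \<Rightarrow> 'g set \<Rightarrow> 'g \<Rightarrow> 'g \<Rightarrow> nat" where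
  "word_dist G X g h = word_length G X (inv\<^bsub>G\<^esub> g \<otimes>\<^bsub>G\<^esub> h)"

text \<open>An edge path is given by the nonempty list of its vertices. This loses no information: an edge
  leaving \<open>g\<close> is labelled by an element \<open>x\<close> of \<open>X \<union> X\<inverse>\<close>, and its other endpoint \<open>g x\<close> determines
  \<open>x\<close>.\<close>

definition cayley_path :: "('g, 'b) monoid_scheme \<Rightarrow> 'g set \<Rightarrow> 'g list \<Rightarrow> bool" where
  "cayley_path G X p \<longleftrightarrow> p \<noteq> [] \<and> set p \<subseteq> carrier G \<and>
    successively (\<lambda>g h. \<exists>x\<in>sym_gens G X. h = g \<otimes>\<^bsub>G\<^esub> x) p"

definition outbound :: "('g, 'b) monoid_scheme \<Rightarrow> 'g set \<Rightarrow> 'g list \<Rightarrow> bool" where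
  "outbound G X p \<longleftrightarrow> sorted_wrt (<) (map (word_dist G X \<one>\<^bsub>G\<^esub>) p)"

definition cone_at :: "('g, 'b) monoid_scheme \<Rightarrow> 'g set \<Rightarrow> 'g \<Rightarrow> 'g list set" where
  "cone_at G X g = {p. cayley_path G X p \<and> outbound G X p \<and> hd p = g}"

definition cone_type :: "('g, 'b) monoid_scheme \<Rightarrow> 'g set \<Rightarrow> 'g \<Rightarrow> 'g list set" where
  "cone_type G X g = map (\<lambda>h. inv\<^bsub>G\<^esub> g \<otimes>\<^bsub>G\<^esub> h) ` cone_at G X g"

definition cone_types :: "('g, 'b) monoid_scheme \<Rightarrow> 'g set \<Rightarrow> 'g list set set" where
  "cone_types G X = cone_type G X ` carrier G"

section \<open>Thompson's group F\<close>

datatype F_gen = X0 | X1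

definition F_relators :: "F_gen gword set" where
  "F_relators =
    {gword_comm
       [(X0, True), (X1, False)]
       [(X0, False), (X1, True), (X0, True)],
     gword_comm
       [(X0, True), (X1, False)]
       [(X0, False), (X0, False), (X1, True), (X0, True), (X0, True)]}"

definition thompson_F :: "F_gen gword set monoid" where
  "thompson_F = presented_group F_relators"

definition x0 :: "F_gen gword set" where
  "x0 = pres_gen F_relators X0"

definition x1 :: "F_gen gword set" where
  "x1 = pres_gen F_relators X1"

lemma group_thompson_F: "group thompson_F"
  unfolding thompson_F_def by (rule group_presented_group)

lemma generate_thompson_F: "generate thompson_F {x0, x1} = carrier thompson_F"
proof -
  have "x \<in> {X0, X1}" for x by (cases x) auto
  then have "range (pres_gen F_relators) = pres_gen F_relators ` {X0, X1}" by blast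
  then have "range (pres_gen F_relators) = {x0, x1}" by (simp add: x0_def x1_def)
  then show ?thesis unfolding thompson_F_def using generate_pres_gen by metis
qed

end

theory Submission
  imports Defs Complex_Main
begin

text \<open>Let \<open>c = x\<^sub>0 x\<^sub>1\<inverse>\<close> and consider the seesaw elements \<open>w = x\<^sub>0\<^sup>k c x\<^sub>0\<^sup>-\<^sup>2\<^sup>k x\<^sub>1 x\<^sub>0\<^sup>k\<close>. Since \<open>c\<close> commutes with
  all conjugates \<open>x\<^sub>0\<^sup>-\<^sup>n x\<^sub>1 x\<^sub>0\<^sup>n\<close>, \<open>n > 0\<close>, both \<open>w x\<^sub>0\<^sup>-\<^sup>k\<close> and \<open>w x\<^sub>0\<^sup>k\<close> have length at most \<open>3k + 3\<close>.
  On the other hand \<open>w\<close> has length at least \<open>4k - 3\<close>: in the piecewise linear action on the real line,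
  \<open>w\<close> has breakpoints near \<open>k\<close> and near \<open>-k\<close>, and a word for \<open>w\<close> must bring both of them to the
  breakpoints of \<open>x\<^sub>1\<close> near \<open>0\<close>. So the length along \<open>w x\<^sub>0\<^sup>i\<close>, which changes by at most \<open>1\<close> in each
  step, rises on long stretches before \<open>i = 0\<close> but does not keep rising until \<open>i = k\<close>. Hence among the
  cones starting on this line there are some that contain a long but not an infinite ray in
  direction \<open>x\<^sub>0\<close>, which finitely many cone types do not allow.\<close>

section \<open>Word length in a presented group\<close>

lemma sym_gens_presented:
  "sym_gens (presented_group R) (range (pres_gen R)) = range (\<lambda>l. pres_class R [l])"
proof -
  have inv: "inv\<^bsub>presented_group R\<^esub> pres_gen R x = pres_class R [(x, False)]" for x
    by (simp add: pres_gen_def inv_pres_class gword_inv_def)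
  show ?thesis
  proof (intro equalityI subsetI)
    fix g assume "g \<in> sym_gens (presented_group R) (range (pres_gen R))"
    then show "g \<in> range (\<lambda>l. pres_class R [l])"
      by (auto simp: sym_gens_def inv) (auto simp: pres_gen_def)
  next
    fix g assume "g \<in> range (\<lambda>l. pres_class R [l])"
    then obtain x b where "g = pres_class R [(x, b)]" by auto
    then show "g \<in> sym_gens (presented_group R) (range (pres_gen R))"
      by (cases b) (auto simp: sym_gens_def inv image_image simp flip: pres_gen_def)
  qed
qed

lemma foldr_mult_letters:
  "foldr (mult (presented_group R)) (map (\<lambda>l. pres_class R [l]) v) \<one>\<^bsub>presented_group R\<^esub> =
    pres_class R v"
  by (induction v) (simp_all add: one_presented_group presented_group_mult)

lemma word_length_presented:
  "word_length (presented_group R) (range (pres_gen R)) (pres_class R u) =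
    (LEAST n. \<exists>v. length v = n \<and> pres_eq R v u)"
proof -
  have "(\<exists>w. length w = n \<and> set w \<subseteq> sym_gens (presented_group R) (range (pres_gen R)) \<and>
      foldr (mult (presented_group R)) w \<one>\<^bsub>presented_group R\<^esub> = pres_class R u) \<longleftrightarrow>
    (\<exists>v. length v = n \<and> pres_eq R v u)" (is "?L \<longleftrightarrow> ?R") for n
  proof
    assume ?L
    then obtain w where w: "length w = n" "set w \<subseteq> range (\<lambda>l. pres_class R [l])"
      "foldr (mult (presented_group R)) w \<one>\<^bsub>presented_group R\<^esub> = pres_class R u"
      by (auto simp: sym_gens_presented)
    from w(2) have "\<forall>g\<in>set w. \<exists>l. g = pres_class R [l]" by blast
    then obtain v where "w = map (\<lambda>l. pres_class R [l]) v"
      unfolding ex_map_conv[symmetric] by blast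
    with w show ?R by (auto simp: foldr_mult_letters pres_class_eq_iff)
  next
    assume ?R
    then obtain v where "length v = n" "pres_eq R v u" by blast
    then show ?L
      by (intro exI[of _ "map (\<lambda>l. pres_class R [l]) v"])
        (auto simp: sym_gens_presented foldr_mult_letters pres_class_eq_iff)
  qed
  then show ?thesis by (simp add: word_length_def)
qed

definition gword_norm :: "'a gword set \<Rightarrow> 'a gword \<Rightarrow> nat" where
  "gword_norm R u = word_length (presented_group R) (range (pres_gen R)) (pres_class R u)"

lemma gword_norm_le: "pres_eq R v u \<Longrightarrow> gword_norm R u \<le> length v"
  unfolding gword_norm_def word_length_presented by (rule Least_le) blast

lemma gword_norm_attained:
  obtains v where "pres_eq R v u" "length v = gword_norm R u"
proof -
  have "\<exists>n v. length v = n \<and> pres_eq R v u" using pres_eq.refl by blast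
  then have "\<exists>v. length v = gword_norm R u \<and> pres_eq R v u"
    unfolding gword_norm_def word_length_presented by (rule LeastI_ex)
  then show ?thesis using that by blast
qed

lemma gword_norm_append_le: "gword_norm R (u @ v) \<le> gword_norm R u + length v"
proof -
  obtain u' where "pres_eq R u' u" "length u' = gword_norm R u" by (rule gword_norm_attained)
  then show ?thesis
    using gword_norm_le[OF pres_eq.append[OF _ pres_eq.refl], of R u' u v] by simp
qed

section \<open>Rays in cone types\<close>

text \<open>Based at the identity, like the translated paths in a cone type; \<open>n\<close> counts
  edges, not vertices.\<close>

definition ray :: "'a gword set \<Rightarrow> 'a \<times> bool \<Rightarrow> nat \<Rightarrow> 'a gword set list" where
  "ray R l n = map (\<lambda>i. pres_class R (replicate i l)) [0..<Suc n]"

lemma ray_in_cone_type_iff: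
  "ray R l n \<in> cone_type (presented_group R) (range (pres_gen R)) (pres_class R u) \<longleftrightarrow>
    (\<forall>i<n. gword_norm R (u @ replicate i l) < gword_norm R (u @ replicate (Suc i) l))"
  (is "_ \<in> cone_type ?G ?X ?g \<longleftrightarrow> ?incr")
proof -
  interpret group ?G by (rule group_presented_group)
  define p where "p = map (\<lambda>i. pres_class R (u @ replicate i l)) [0..<Suc n]"
  have g: "?g \<in> carrier ?G" by (simp add: carrier_presented_group)
  have dist: "word_dist ?G ?X \<one>\<^bsub>?G\<^esub> (pres_class R w) = gword_norm R w" for w
    by (simp add: word_dist_def gword_norm_def carrier_presented_group)
  have ray: "ray R l n = map (\<lambda>h. inv\<^bsub>?G\<^esub> ?g \<otimes>\<^bsub>?G\<^esub> h) p"
  proof -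
    have "pres_class R w \<in> carrier ?G" for w by (simp add: carrier_presented_group)
    then have "inv\<^bsub>?G\<^esub> ?g \<otimes>\<^bsub>?G\<^esub> pres_class R (u @ w) = pres_class R w" for w
      using g by (simp add: m_assoc[symmetric] flip: presented_group_mult)
    then show ?thesis by (simp add: ray_def p_def)
  qed
  have path: "cayley_path ?G ?X p"
    unfolding cayley_path_def
  proof (intro conjI)
    show "p \<noteq> []" by (simp add: p_def)
    show "set p \<subseteq> carrier ?G" by (auto simp: p_def carrier_presented_group)
    show "successively (\<lambda>g h. \<exists>x\<in>sym_gens ?G ?X. h = g \<otimes>\<^bsub>?G\<^esub> x) p"
      by (cases l) (auto simp: p_def successively_conv_nth presented_group_mult sym_gens_presented
          simp flip: replicate_append_same simp del: upt_Suc)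
  qed
  have hd: "hd p = ?g" by (simp add: p_def hd_map del: upt_Suc)
  have out: "outbound ?G ?X p \<longleftrightarrow> ?incr"
  proof -
    have "outbound ?G ?X p \<longleftrightarrow>
        sorted_wrt (<) (map (\<lambda>i. gword_norm R (u @ replicate i l)) [0..<Suc n])"
      by (simp add: outbound_def p_def dist o_def del: upt_Suc)
    also have "\<dots> \<longleftrightarrow> ?incr"
      by (auto simp: sorted_wrt_iff_nth_Suc_transp simp del: upt_Suc replicate_Suc)
    finally show ?thesis .
  qed
  have "ray R l n \<in> cone_type ?G ?X ?g \<longleftrightarrow> p \<in> cone_at ?G ?X ?g"
  proof
    assume "ray R l n \<in> cone_type ?G ?X ?g"
    then obtain q where q: "q \<in> cone_at ?G ?X ?g"
      "map (\<lambda>h. inv\<^bsub>?G\<^esub> ?g \<otimes>\<^bsub>?G\<^esub> h) p = map (\<lambda>h. inv\<^bsub>?G\<^esub> ?g \<otimes>\<^bsub>?G\<^esub> h) q"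
      by (auto simp: cone_type_def ray)
    \<comment> \<open>Injectivity of the translation leaves \<open>p\<close> as the only path that
      can map to the ray.\<close>
    have "inj_on (\<lambda>h. inv\<^bsub>?G\<^esub> ?g \<otimes>\<^bsub>?G\<^esub> h) (carrier ?G)"
      using g by (simp add: inj_on_def)
    moreover have "set p \<union> set q \<subseteq> carrier ?G"
      using q(1) path by (auto simp: cone_at_def cayley_path_def)
    ultimately have "p = q" using q(2) by (blast intro: map_inj_on inj_on_subset)
    with q(1) show "p \<in> cone_at ?G ?X ?g" by simp
  next
    assume "p \<in> cone_at ?G ?X ?g"
    then show "ray R l n \<in> cone_type ?G ?X ?g" by (simp add: cone_type_def ray)
  qed
  also have "\<dots> \<longleftrightarrow> ?incr" by (simp add: cone_at_def path hd out)
  finally show ?thesis .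
qed

text \<open>Rays in a cone type can be shortened, so a cone type that omits a ray omits all longer
  ones. Finitely many cone types bound the least omitted lengths, and a ray reaching that bound
  extends forever.\<close>

lemma infinite_cone_types_if_rays:
  assumes "\<And>n. \<exists>u m. ray R l n \<in> cone_type (presented_group R) (range (pres_gen R)) (pres_class R u)
    \<and> ray R l m \<notin> cone_type (presented_group R) (range (pres_gen R)) (pres_class R u)"
  shows "infinite (cone_types (presented_group R) (range (pres_gen R)))"
proof
  let ?C = "\<lambda>u. cone_type (presented_group R) (range (pres_gen R)) (pres_class R u)"
  assume "finite (cone_types (presented_group R) (range (pres_gen R)))"
  then have fin: "finite (range ?C)"
    by (simp add: cone_types_def carrier_presented_group image_image)
  \<comment> \<open>Arbitrary if \<open>T\<close> contains all rays; its meaning matters only for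
    the cone type of \<open>u\<close> below.\<close>
  define b where "b T = (LEAST m. ray R l m \<notin> T)" for T
  obtain N where N: "\<And>u. b (?C u) \<le> N"
    using finite_nat_set_iff_bounded_le[of "b ` range ?C"] fin by auto
  obtain u m where u: "ray R l N \<in> ?C u" "ray R l m \<notin> ?C u" using assms by blast
  have "ray R l (b (?C u)) \<notin> ?C u" unfolding b_def using u(2) by (rule LeastI)
  moreover have "ray R l (b (?C u)) \<in> ?C u"
    using u(1) N[of u] by (simp add: ray_in_cone_type_iff)
  ultimately show False by simp
qed

section \<open>A lower bound for word length in Thompson's group\<close>

text \<open>The piecewise linear action carried over to the real line so that \<open>x0\<close> is a
  translation. Under \<open>foldr\<close> the last letter acts first, so the orbit of a point
  follows the suffixes of a word.\<close>

fun act :: "F_gen \<times> bool \<Rightarrow> real \<Rightarrow> real" where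
  "act (X0, True) t = t - 1"
| "act (X0, False) t = t + 1"
| "act (X1, True) t = (if t \<le> 0 then t else if t \<le> 2 then t / 2 else t - 1)"
| "act (X1, False) t = (if t \<le> 0 then t else if t \<le> 1 then 2 * t else t + 1)"

abbreviation act_word :: "F_gen gword \<Rightarrow> real \<Rightarrow> real" where
  "act_word \<equiv> foldr act"

lemma act_cancel: "act (x, b) (act (x, \<not> b) t) = t"
  by (cases x; cases b) auto

text \<open>Disjoint supports: \<open>x0 x1^-1\<close> fixes every t \<ge> 1, and both conjugates of
  \<open>x1\<close> fix every t \<le> 1.\<close>

lemma act_word_relator: "r \<in> F_relators \<Longrightarrow> act_word r t = t"
  unfolding F_relators_def gword_comm_def gword_inv_def
  by (auto simp: field_simps)

lemma act_word_pres_eq: "pres_eq F_relators u v \<Longrightarrow> act_word u = act_word v"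
proof (induction rule: pres_eq.induct)
  case (append u u' v v')
  then show ?case by (simp add: fun_eq_iff)
qed (auto simp: fun_eq_iff act_cancel act_word_relator)

definition expo :: "'a \<Rightarrow> 'a gword \<Rightarrow> int" where
  "expo y w = (\<Sum>(x, b)\<leftarrow>w. if x \<noteq> y then 0 else if b then 1 else - 1)"

lemma expo_simps [simp]:
  "expo y [] = 0"
  "expo y ((x, b) # w) = (if x \<noteq> y then 0 else if b then 1 else - 1) + expo y w"
  "expo y (u @ v) = expo y u + expo y v"
  by (simp_all add: expo_def)

lemma expo_replicate [simp]:
  "expo y (replicate n (x, b)) = (if x \<noteq> y then 0 else if b then int n else - int n)"
  by (induction n) auto

lemma expo_pres_eq: "pres_eq F_relators u v \<Longrightarrow> expo y u = expo y v"
proof (induction rule: pres_eq.induct)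
  case (relator r)
  then show ?case by (auto simp: F_relators_def gword_comm_def gword_inv_def)
qed auto

lemma abs_expo_le: "\<bar>expo X0 w\<bar> + \<bar>expo X1 w\<bar> \<le> int (length w)"
proof (induction w)
  case (Cons l w)
  then show ?case by (cases l; cases "fst l"; cases "snd l") auto
qed simp

text \<open>The exponent sums of the suffixes form a walk in the integer plane, one unit step per
  letter.\<close>

lemma abs_expo_drop_le:
  assumes "i \<le> j" "j \<le> length w"
  shows "\<bar>expo X0 (drop i w) - expo X0 (drop j w)\<bar> + \<bar>expo X1 (drop i w) - expo X1 (drop j w)\<bar>
    \<le> int j - int i"
proof -
  have "drop i w = take (j - i) (drop i w) @ drop j w"
    using assms by (metis append_take_drop_id drop_drop le_add_diff_inverse2)
  then have "expo y (drop i w) = expo y (take (j - i) (drop i w)) + expo y (drop j w)" for y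
    by (metis expo_simps(3))
  then show ?thesis using abs_expo_le[of "take (j - i) (drop i w)"] assms by simp
qed

text \<open>From 2 on, \<open>x1\<close> acts as the same translation as \<open>x0\<close>, so the
  exponent sums of a suffix determine the position.\<close>

lemma act_word_right:
  assumes "\<And>i. t - real_of_int (expo X0 (drop i w) + expo X1 (drop i w)) \<ge> 2"
  shows "act_word w t = t - real_of_int (expo X0 w + expo X1 w)"
  using assms
proof (induction w)
  case (Cons l w)
  have "act_word w t = t - real_of_int (expo X0 w + expo X1 w)"
    using Cons.prems[of "Suc _"] by (intro Cons.IH) simp
  moreover have "act_word w t \<ge> 2" using Cons.prems[of 1] calculation by simp
  ultimately show ?case by (cases l; cases "fst l"; cases "snd l") auto
qed simp

text \<open>Left of 0, \<open>x1\<close> acts trivially, so only the exponent of \<open>x0\<close>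
  counts.\<close>

lemma act_word_left:
  assumes "\<And>i. t - real_of_int (expo X0 (drop i w)) \<le> 0"
  shows "act_word w t = t - real_of_int (expo X0 w)"
  using assms
proof (induction w)
  case (Cons l w)
  have "act_word w t = t - real_of_int (expo X0 w)"
    using Cons.prems[of "Suc _"] by (intro Cons.IH) simp
  moreover have "act_word w t \<le> 0" using Cons.prems[of 1] calculation by simp
  ultimately show ?case by (cases l; cases "fst l"; cases "snd l") auto
qed simp

text \<open>The translations \<open>t - 1\<close> that \<open>act_word w\<close> would be near both ends do not fix the two given
  points, so a suffix of \<open>w\<close> brings the right one, and another the left one, to the breakpoints of
  \<open>x\<^sub>1\<close>. In terms of exponent sums this is a round trip of length \<open>4k\<close>, up to a constant.\<close>

lemma length_ge_if_fixes:
  assumes k: "act_word w (real k) = real k" "act_word w (1 - real k) = 1 - real k"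
    and e: "expo X0 w = 1" "expo X1 w = 0"
  shows "4 * k \<le> length w + 3"
proof -
  let ?A = "\<lambda>i. expo X0 (drop i w)" and ?B = "\<lambda>i. expo X1 (drop i w)"
  obtain i where i: "real k - real_of_int (?A i + ?B i) < 2"
  proof (rule ccontr)
    assume "\<not> thesis"
    with that have "act_word w (real k) = real k - real_of_int (expo X0 w + expo X1 w)"
      by (intro act_word_right) (meson not_le)
    with k e show False by simp
  qed
  obtain j where j: "1 - real k - real_of_int (?A j) > 0"
  proof (rule ccontr)
    assume "\<not> thesis"
    with that have "act_word w (1 - real k) = 1 - real k - real_of_int (expo X0 w)"
      by (intro act_word_left) (meson not_le)
    with k e show False by simp
  qed
  define i' j' where "i' = min i (length w)" and "j' = min j (length w)"
  have drop: "drop i w = drop i' w" "drop j w = drop j' w"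
    by (auto simp: i'_def j'_def min_def)
  have "real_of_int (int k) < real_of_int (?A i' + ?B i' + 2)" using i by (simp add: drop)
  then have i': "int k - 1 \<le> ?A i' + ?B i'" unfolding of_int_less_iff by simp
  have "real_of_int (?A j') < real_of_int (1 - int k)" using j by (simp add: drop)
  then have j': "?A j' \<le> - int k" unfolding of_int_less_iff by simp
  have le: "i' \<le> length w" "j' \<le> length w" by (simp_all add: i'_def j'_def)
  \<comment> \<open>The exponent walk leads from (1, 0) to (0, 0) and meets the half-planes a + b
    \<ge> k - 1 and a \<le> -k. In this order it takes at least 4k - 3 steps, in the other at least
    4k - 1.\<close>
  show ?thesis
  proof (cases "i' \<le> j'")
    case True
    then show ?thesis
      using abs_expo_drop_le[of 0 i' w] abs_expo_drop_le[of i' j' w]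
        abs_expo_drop_le[of j' "length w" w] le i' j' e by simp
  next
    case False
    then show ?thesis
      using abs_expo_drop_le[of 0 j' w] abs_expo_drop_le[of j' i' w]
        abs_expo_drop_le[of i' "length w" w] le i' j' e by simp
  qed
qed

section \<open>Commutation relations\<close>

context group
begin

text \<open>This is how two relators yield the infinite family: \<open>x (n + 3)\<close> is the
  conjugate of \<open>x (n + 2)\<close> by \<open>x 1\<close>, so it commutes with \<open>c\<close>
  if these two do.\<close>

lemma commute_conj_pow:
  assumes a: "a \<in> carrier G" and b: "b \<in> carrier G"
    and x: "\<And>n. x n = inv (a [^] n) \<otimes> b \<otimes> a [^] (n::nat)"
    and c: "c = a \<otimes> inv b"
    and 1: "c \<otimes> x 1 = x 1 \<otimes> c" and 2: "c \<otimes> x 2 = x 2 \<otimes> c"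
  shows "c \<otimes> x (Suc n) = x (Suc n) \<otimes> c"
proof -
  have xc: "x n \<in> carrier G" for n using a b by (simp add: x)
  have cc: "c \<in> carrier G" using a b by (simp add: c)
  have conj: "x (Suc n) = inv a \<otimes> x n \<otimes> a" for n
    using a b by (simp add: x inv_mult_group m_assoc nat_pow_Suc2)
  \<comment> \<open>On elements commuting with \<open>c\<close>, conjugation by \<open>b\<close>
    agrees with conjugation by \<open>a\<close>. Conjugating that relation by \<open>a\<close> gives
    the claim.\<close>
  have shift: "x (Suc n) \<otimes> x 1 = x 1 \<otimes> x (Suc (Suc n))" if "c \<otimes> x n = x n \<otimes> c" for n
  proof -
    have "inv b \<otimes> x n \<otimes> b = inv a \<otimes> (c \<otimes> x n) \<otimes> b"
      using a b xc by (simp add: c m_assoc[symmetric])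
    also have "\<dots> = x (Suc n)"
      unfolding that using a b xc by (simp add: c conj m_assoc)
    finally have "b \<otimes> x (Suc n) = b \<otimes> (inv b \<otimes> x n \<otimes> b)" by simp
    then have *: "x n \<otimes> b = b \<otimes> x (Suc n)" using a b xc by (simp add: m_assoc[symmetric])
    have x1: "x 1 = inv a \<otimes> b \<otimes> a" using a b by (simp add: x)
    have "x (Suc n) \<otimes> x 1 = inv a \<otimes> (x n \<otimes> (a \<otimes> inv a) \<otimes> b) \<otimes> a"
      unfolding conj[of n] x1 using a b xc by (simp only: m_assoc m_closed inv_closed)
    also have "\<dots> = inv a \<otimes> (b \<otimes> (a \<otimes> inv a) \<otimes> x (Suc n)) \<otimes> a"
      using a b xc * by simp
    also have "\<dots> = x 1 \<otimes> x (Suc (Suc n))"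
      unfolding conj[of "Suc n"] x1 using a b xc by (simp only: m_assoc m_closed inv_closed)
    finally show ?thesis .
  qed
  show ?thesis
  proof (induction n rule: less_induct)
    case (less n)
    consider "n = 0" | "n = 1" | m where "n = Suc (Suc m)" by (metis One_nat_def not0_implies_Suc)
    then show ?case
    proof cases
      case 3
      have c1: "c \<otimes> x (Suc m) = x (Suc m) \<otimes> c" and c2: "c \<otimes> x (Suc n') = x (Suc n') \<otimes> c"
        if "n' = Suc m" for n' using less.IH 3 that by auto
      have "x 1 \<otimes> (c \<otimes> x (Suc n)) = c \<otimes> (x 1 \<otimes> x (Suc n))"
        using 1 xc cc by (metis m_assoc)
      also have "\<dots> = c \<otimes> (x n \<otimes> x 1)" using shift[OF c1] 3 by simp
      also have "\<dots> = (x n \<otimes> x 1) \<otimes> c"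
        using 1 c2[of "Suc m"] 3 xc cc by (metis m_assoc)
      also have "\<dots> = x 1 \<otimes> (x (Suc n) \<otimes> c)"
        using shift[OF c1] 3 xc cc by (simp add: m_assoc)
      finally show ?thesis using xc cc by simp
    qed (use 1 2 in \<open>simp_all add: numeral_2_eq_2\<close>)
  qed
qed

end

text \<open>The element \<open>w\<close> of the introduction is \<open>seesaw k @ replicate k (X0, True)\<close>.\<close>

definition seesaw :: "nat \<Rightarrow> F_gen gword" where
  "seesaw k = replicate k (X0, True) @ [(X0, True), (X1, False)] @ replicate (2 * k) (X0, False) @
    [(X1, True)]"

section \<open>Lengths of the seesaw elements\<close>

lemma pres_eq_cancel_replicate:
  "pres_eq R (replicate n (x, b) @ replicate (n + m) (x, \<not> b)) (replicate m (x, \<not> b))"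
proof (induction n)
  case 0
  show ?case by (simp add: pres_eq.refl)
next
  case (Suc n)
  have "replicate (Suc n) (x, b) @ replicate (Suc n + m) (x, \<not> b) =
      replicate n (x, b) @ [(x, b), (x, \<not> b)] @ replicate (n + m) (x, \<not> b)"
    by (simp add: replicate_app_Cons_same)
  moreover have "pres_eq R (replicate n (x, b) @ [(x, b), (x, \<not> b)] @ replicate (n + m) (x, \<not> b))
      (replicate n (x, b) @ [] @ replicate (n + m) (x, \<not> b))"
    by (intro pres_eq.append pres_eq.refl pres_eq.cancel)
  ultimately show ?case using Suc by (auto intro: pres_eq.trans)
qed

lemma pres_class_commute_if_relator:
  assumes "gword_comm u v \<in> R"
  shows "pres_class R (u @ v) = pres_class R (v @ u)"
proof -
  interpret group "presented_group R" by (rule group_presented_group)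
  have "pres_class R (gword_comm u v) = \<one>\<^bsub>presented_group R\<^esub>"
    using assms by (simp add: one_presented_group pres_class_eq_iff pres_eq.relator)
  then have "pres_class R (u @ v) \<otimes>\<^bsub>presented_group R\<^esub> inv\<^bsub>presented_group R\<^esub> pres_class R (v @ u) =
      \<one>\<^bsub>presented_group R\<^esub>"
    by (simp add: gword_comm_def inv_pres_class presented_group_mult gword_inv_def)
  moreover have "pres_class R w \<in> carrier (presented_group R)" for w
    by (simp add: carrier_presented_group)
  ultimately show ?thesis using inv_equality by fastforce
qed

lemma conj_word_commute:
  assumes "n > 0"
  shows "pres_eq F_relators
    ([(X0, True), (X1, False)] @ replicate n (X0, False) @ [(X1, True)] @ replicate n (X0, True))
    (replicate n (X0, False) @ [(X1, True)] @ replicate n (X0, True) @ [(X0, True), (X1, False)])"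
proof -
  let ?G = "presented_group F_relators" and ?cls = "pres_class F_relators"
  interpret group ?G by (rule group_presented_group)
  let ?a = "?cls [(X0, True)]" and ?b = "?cls [(X1, True)]"
  let ?x = "\<lambda>n. ?cls (replicate n (X0, False) @ [(X1, True)] @ replicate n (X0, True))"
  let ?c = "?cls [(X0, True), (X1, False)]"
  have pow: "?a [^]\<^bsub>?G\<^esub> n = ?cls (replicate n (X0, True))" for n :: nat
    by (induction n) (simp_all add: one_presented_group presented_group_mult replicate_append_same)
  have x: "?x n = inv\<^bsub>?G\<^esub> (?a [^]\<^bsub>?G\<^esub> n) \<otimes>\<^bsub>?G\<^esub> ?b \<otimes>\<^bsub>?G\<^esub> ?a [^]\<^bsub>?G\<^esub> n" for n :: nat
    by (simp add: pow inv_pres_class gword_inv_def presented_group_mult)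
  have c: "?c = ?a \<otimes>\<^bsub>?G\<^esub> inv\<^bsub>?G\<^esub> ?b"
    by (simp add: inv_pres_class gword_inv_def presented_group_mult)
  have "?c \<otimes>\<^bsub>?G\<^esub> ?x 1 = ?x 1 \<otimes>\<^bsub>?G\<^esub> ?c" "?c \<otimes>\<^bsub>?G\<^esub> ?x 2 = ?x 2 \<otimes>\<^bsub>?G\<^esub> ?c"
    unfolding presented_group_mult
    by (intro pres_class_commute_if_relator; simp add: F_relators_def numeral_2_eq_2)+
  from commute_conj_pow[OF _ _ x c this, of "n - 1"] assms
  have "?c \<otimes>\<^bsub>?G\<^esub> ?x n = ?x n \<otimes>\<^bsub>?G\<^esub> ?c" by (simp add: carrier_presented_group)
  then show ?thesis by (simp add: presented_group_mult pres_class_eq_iff)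
qed

text \<open>Moving \<open>x0 x1^-1\<close> past the conjugate of \<open>x1\<close> by
  \<open>x0^(2k)\<close> lets \<open>x0^k\<close> cancel, which leaves a word of length 3k +
  3.\<close>

lemma seesaw_end:
  assumes "k > 0"
  shows "pres_eq F_relators
    (replicate k (X0, False) @ [(X1, True)] @ replicate (2 * k) (X0, True) @ [(X0, True), (X1, False)])
    (seesaw k @ replicate (2 * k) (X0, True))"
proof -
  let ?r = "\<lambda>n b. replicate n (X0, b)" and ?c = "[(X0, True), (X1, False)]"
  have "pres_eq F_relators (?r k True @ ?c @ ?r (2 * k) False @ [(X1, True)] @ ?r (2 * k) True)
      (?r k True @ ?r (2 * k) False @ [(X1, True)] @ ?r (2 * k) True @ ?c)"
    using assms by (intro pres_eq.append pres_eq.refl conj_word_commute) simp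
  moreover have "pres_eq F_relators
      ((?r k True @ ?r (2 * k) False) @ [(X1, True)] @ ?r (2 * k) True @ ?c)
      (?r k False @ [(X1, True)] @ ?r (2 * k) True @ ?c)"
    using pres_eq_cancel_replicate[of F_relators k X0 True k]
    by (intro pres_eq.append pres_eq.refl) (simp add: mult_2)
  ultimately show ?thesis
    by (auto simp: seesaw_def intro: pres_eq.trans pres_eq.sym)
qed

lemma act_pow:
  "(act (X0, True) ^^ n) t = t - real n"
  "(act (X0, False) ^^ n) t = t + real n"
  by (induction n) auto

lemma seesaw_middle:
  assumes "k > 0"
  shows "4 * k \<le> gword_norm F_relators (seesaw k @ replicate k (X0, True)) + 3"
proof -
  let ?w = "seesaw k @ replicate k (X0, True)"
  obtain v where v: "pres_eq F_relators v ?w" "length v = gword_norm F_relators ?w"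
    by (rule gword_norm_attained)
  \<comment> \<open>After \<open>x0^k\<close> the points are 0 and 1 - 2k, fixed by
    \<open>x1\<close>; after \<open>x0^(-2k)\<close> they are 2k and 1, fixed by
    \<open>x0 x1^-1\<close>.\<close>
  have "act_word ?w (real k) = real k" "act_word ?w (1 - real k) = 1 - real k"
    using assms by (auto simp: seesaw_def act_pow)
  moreover have "expo X0 ?w = 1" "expo X1 ?w = 0" by (simp_all add: seesaw_def)
  ultimately show ?thesis
    using length_ge_if_fixes[of v k] v act_word_pres_eq[OF v(1)] expo_pres_eq[OF v(1)] by simp
qed

section \<open>Increasing runs of the length function\<close>

text \<open>Cut the range into \<open>m\<close> blocks of length \<open>n\<close>. A block that is
  not increasing throughout gains at most n - 1, so if all failed, the total gain would be at most m
  n - m.\<close>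

lemma increasing_run:
  fixes f :: "nat \<Rightarrow> nat"
  assumes lip: "\<And>i. f (Suc i) \<le> f i + 1" and large: "f 0 + m * n < f (m * n) + m"
  obtains j where "j \<le> m * n" "\<And>i. i < n \<Longrightarrow> f (j + i) < f (j + Suc i)"
proof -
  have lip': "f (j + i) \<le> f j + i" for i j
    by (induction i) (use lip[of "j + _"] in \<open>auto intro: order_trans\<close>)
  have "\<exists>j<m. \<forall>i<n. f (j * n + i) < f (j * n + Suc i)"
  proof (rule ccontr)
    assume *: "\<not> ?thesis"
    have "f (j * n) + j \<le> f 0 + j * n" if "j \<le> m" for j
      using that
    proof (induction j)
      case (Suc j)
      obtain i where i: "i < n" "f (j * n + Suc i) \<le> f (j * n + i)"
        using * Suc.prems by (metis Suc_le_lessD linorder_not_less)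
      have "f (j * n + n) \<le> f (j * n + Suc i) + (n - Suc i)"
        using lip'[of "j * n + Suc i" "n - Suc i"] i by simp
      then have "f (j * n + n) + 1 \<le> f (j * n) + n"
        using i lip'[of "j * n" i] by linarith
      then show ?case using Suc by (simp add: add.commute)
    qed simp
    from this[of m] large show False by simp
  qed
  then obtain j where j: "j < m" "\<forall>i<n. f (j * n + i) < f (j * n + Suc i)" by blast
  then have "j * n \<le> m * n" by simp
  with j(2) that show ?thesis by blast
qed

lemma increasing_ge:
  fixes f :: "nat \<Rightarrow> nat"
  assumes "\<And>i. i < n \<Longrightarrow> f i < f (Suc i)"
  shows "f 0 + n \<le> f n"
  using assms by (induction n) (fastforce simp: Suc_le_eq)+

lemma seesaw_rays:
  "\<exists>u m. ray F_relators (X0, True) n \<in>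
      cone_type (presented_group F_relators) (range (pres_gen F_relators)) (pres_class F_relators u)
    \<and> ray F_relators (X0, True) m \<notin>
      cone_type (presented_group F_relators) (range (pres_gen F_relators)) (pres_class F_relators u)"
proof -
  \<comment> \<open>From 0 to \<open>k\<close> the length gains at least (4k - 3) - (3k + 3) = k -
    6, so one of 7 blocks increases throughout. \<open>Suc n\<close> ensures k \<ge> 7 even for n =
    0.\<close>
  define k where "k = 7 * Suc n"
  define f where "f i = gword_norm F_relators (seesaw k @ replicate i (X0, True))" for i
  have lip: "f (Suc i) \<le> f i + 1" for i
    using gword_norm_append_le[of F_relators "seesaw k @ replicate i (X0, True)" "[(X0, True)]"]
    by (simp add: f_def replicate_append_same)
  have f0: "f 0 \<le> 3 * k + 3"
    using gword_norm_le[OF pres_eq.refl, of F_relators "seesaw k"] by (simp add: f_def seesaw_def)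
  have fk: "4 * k \<le> f k + 3" unfolding f_def by (rule seesaw_middle) (simp add: k_def)
  have f2k: "f (2 * k) \<le> 3 * k + 3"
    using gword_norm_le[OF seesaw_end, of k] by (simp add: f_def k_def)
  obtain j where j: "j \<le> k" "\<And>i. i < Suc n \<Longrightarrow> f (j + i) < f (j + Suc i)"
  proof (rule increasing_run[of f, OF lip])
    show "f 0 + 7 * Suc n < f (7 * Suc n) + 7" using f0 fk unfolding k_def by linarith
  qed (use that in \<open>simp add: k_def\<close>)
  define u where "u = seesaw k @ replicate j (X0, True)"
  have ray: "ray F_relators (X0, True) N \<in>
      cone_type (presented_group F_relators) (range (pres_gen F_relators)) (pres_class F_relators u)
      \<longleftrightarrow> (\<forall>i<N. f (j + i) < f (j + Suc i))" for N
  proof -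
    have "gword_norm F_relators (u @ replicate i (X0, True)) = f (j + i)" for i
      by (simp add: u_def f_def replicate_add)
    then show ?thesis by (simp add: ray_in_cone_type_iff del: replicate_Suc)
  qed
  \<comment> \<open>A ray reaching 2k would force length at least 5k - 3 there, above the bound 3k +
    3.\<close>
  have "\<not> (\<forall>i<2 * k - j. f (j + i) < f (j + Suc i))"
  proof
    assume *: "\<forall>i<2 * k - j. f (j + i) < f (j + Suc i)"
    have "f (k + i) < f (k + Suc i)" if "i < k" for i
      using *[rule_format, of "k - j + i"] j(1) that by simp
    then have "f k + k \<le> f (k + k)" using increasing_ge[of k "\<lambda>i. f (k + i)"] by simp
    then show False using f2k fk by (simp add: k_def mult_2)
  qed
  moreover have "\<forall>i<n. f (j + i) < f (j + Suc i)" using j(2) by simp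
  ultimately show ?thesis using ray by blast
qed

theorem theorem28: "infinite (cone_types thompson_F {x0, x1})"
proof -
  have "range (pres_gen F_relators) = {x0, x1}"
  proof -
    have "(UNIV :: F_gen set) = {X0, X1}" using F_gen.exhaust by blast
    then have "range (pres_gen F_relators) = pres_gen F_relators ` {X0, X1}" by (rule arg_cong)
    then show ?thesis by (simp add: x0_def x1_def)
  qed
  then show ?thesis
    using infinite_cone_types_if_rays[OF seesaw_rays] by (simp add: thompson_F_def)
qed

end
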